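(* The Jeffreys prior for the two-parameter Pareto model with densities $p(x\,|\,\alpha,\beta)=\frac{\beta\alpha^\beta}{x^{\beta+1}}I_{[x\ge\alpha]}$, $\alpha>0,\ \beta>0$, is $p(\alpha,\beta)\propto \frac1\alpha$ on $\alpha>0,\ \beta>0$; it is an improper prior, since its integral is infinite. Let $\mathbf x=(x_1,\dots,x_n)$ be data observed from a Pareto distribution with unknown parameters $\alpha,\beta$, and put $q_1(\mathbf x)=\min_{1\le i\le n}x_i$ and $q_2(\mathbf x)=\sum_{i=1}^n\log x_i$. Then the joint posterior probability density of $(\alpha,\beta)$ obtained from this prior is, for $\alpha,\beta>0$, \[ p(\alpha,\beta\,|\,\mathbf x)=\frac{n\left[q_2(\mathbf x)-n\log q_1(\mathbf x)\right]^n}{\Gamma(n)}\,\beta^n\alpha^{n\beta-1}\exp\left[-q_2(\mathbf x)\beta\right]I_{[0<\alpha\le q_1(\mathbf x)]}. \]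
   Context: $I_{[\cdot]}$ denotes the indicator function and $\Gamma$ the gamma function. The Jeffreys prior is the (possibly improper) prior whose density in the parameters is proportional to $\sqrt{\det[g_{ij}]}$, the density of the Riemannian volume form of the Fisher--Rao metric $g_{ij}=E[\partial_i \log p(X\,|\,\alpha,\beta)\,\partial_j \log p(X\,|\,\alpha,\beta)]$, where $X$ has density $p(\cdot\,|\,\alpha,\beta)$, $\partial_1=\partial/\partial\alpha$ and $\partial_2=\partial/\partial\beta$; for the Pareto family the metric is $g=\frac{\beta^2}{\alpha^2}\,\mathrm d\alpha\otimes\mathrm d\alpha+\frac{1}{\beta^2}\,\mathrm d\beta\otimes\mathrm d\beta$. The joint probability density of the observations is \[ p(\mathbf x\,|\,\alpha,\beta)=\beta^n\alpha^{n\beta}\Big(\prod_{i=1}^n x_i\Big)^{-\beta-1}I_{[\min_{1\le i\le n} x_i\ge\alpha]}, \] and the posterior density is given by Bayes' theorem as \[ p(\alpha,\beta\,|\,\mathbf x)=\frac{p(\mathbf x\,|\,\alpha,\beta)\,p(\alpha,\beta)}{\int_0^\infty\int_0^\infty p(\mathbf x\,|\,\alpha,\beta)\,p(\alpha,\beta)\,\mathrm d\alpha\,\mathrm d\beta}. \] *)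

theory Defs
  imports "HOL-Analysis.Analysis"
begin

definition pareto_density :: "real \<Rightarrow> real \<Rightarrow> real \<Rightarrow> real" where
  "pareto_density \<alpha> \<beta> x = \<beta> * \<alpha> powr \<beta> / x powr (\<beta> + 1) * indicator {\<alpha>..} x"

text \<open>A two-parameter model is a function \<open>p\<close> giving the density \<open>p \<alpha> \<beta>\<close> with respect to
  Lebesgue measure, for \<open>\<alpha> > 0\<close> and \<open>\<beta> > 0\<close>.  The index type \<open>2\<close> has the two elements
  \<open>1\<close> and \<open>2 = 0\<close>.\<close>

definition model_law :: "(real \<Rightarrow> real \<Rightarrow> real \<Rightarrow> real) \<Rightarrow> real \<Rightarrow> real \<Rightarrow> real measure" where
  "model_law p \<alpha> \<beta> = density lborel (\<lambda>x. ennreal (p \<alpha> \<beta> x))"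

definition score :: "(real \<Rightarrow> real \<Rightarrow> real \<Rightarrow> real) \<Rightarrow> 2 \<Rightarrow> real \<Rightarrow> real \<Rightarrow> real \<Rightarrow> real" where
  "score p i \<alpha> \<beta> x =
     (if i = 1 then deriv (\<lambda>a. ln (p a \<beta> x)) \<alpha> else deriv (\<lambda>b. ln (p \<alpha> b x)) \<beta>)"

definition fisher_metric :: "(real \<Rightarrow> real \<Rightarrow> real \<Rightarrow> real) \<Rightarrow> real \<Rightarrow> real \<Rightarrow> real^2^2" where
  "fisher_metric p \<alpha> \<beta> =
     (\<chi> i j. integral\<^sup>L (model_law p \<alpha> \<beta>) (\<lambda>x. score p i \<alpha> \<beta> x * score p j \<alpha> \<beta> x))"

text \<open>Both \<open>deriv\<close> and the Bochner integral are total, so it is recorded separately that the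
  partial derivatives and expectations in the Fisher--Rao metric really exist.\<close>

definition fisher_metric_exists :: "(real \<Rightarrow> real \<Rightarrow> real \<Rightarrow> real) \<Rightarrow> real \<Rightarrow> real \<Rightarrow> bool" where
  "fisher_metric_exists p \<alpha> \<beta> \<longleftrightarrow>
     (AE x in model_law p \<alpha> \<beta>.
        (\<lambda>a. ln (p a \<beta> x)) field_differentiable at \<alpha> \<and>
        (\<lambda>b. ln (p \<alpha> b x)) field_differentiable at \<beta>) \<and>
     (\<forall>i j. integrable (model_law p \<alpha> \<beta>) (\<lambda>x. score p i \<alpha> \<beta> x * score p j \<alpha> \<beta> x))"

text \<open>A Jeffreys prior is determined only up to a positive constant.\<close>

definition jeffreys_prior ::
    "(real \<Rightarrow> real \<Rightarrow> real \<Rightarrow> real) \<Rightarrow> (real \<Rightarrow> real \<Rightarrow> real) \<Rightarrow> bool" where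
  "jeffreys_prior p \<pi> \<longleftrightarrow>
     (\<forall>\<alpha>>0. \<forall>\<beta>>0. fisher_metric_exists p \<alpha> \<beta>) \<and>
     (\<exists>c>0. \<forall>\<alpha>>0. \<forall>\<beta>>0. \<pi> \<alpha> \<beta> = c * sqrt (det (fisher_metric p \<alpha> \<beta>)))"

text \<open>The iterated integral over \<open>\<alpha>, \<beta> > 0\<close>, with values in \<open>[0, \<infinity>]\<close>; it is meant for
  nonnegative integrands.\<close>

definition param_integral :: "(real \<Rightarrow> real \<Rightarrow> real) \<Rightarrow> ennreal" where
  "param_integral f =
     (\<integral>\<^sup>+\<beta>\<in>{0<..}. (\<integral>\<^sup>+\<alpha>\<in>{0<..}. ennreal (f \<alpha> \<beta>) \<partial>lborel) \<partial>lborel)"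

definition improper_prior :: "(real \<Rightarrow> real \<Rightarrow> real) \<Rightarrow> bool" where
  "improper_prior \<pi> \<longleftrightarrow> param_integral \<pi> = \<infinity>"

text \<open>Observations \<open>x\<^sub>1, \<dots>, x\<^sub>n\<close> are the values of \<open>x :: nat \<Rightarrow> real\<close> on \<open>{1..n}\<close>.\<close>

definition joint_density ::
    "(real \<Rightarrow> real \<Rightarrow> real \<Rightarrow> real) \<Rightarrow> nat \<Rightarrow> (nat \<Rightarrow> real) \<Rightarrow> real \<Rightarrow> real \<Rightarrow> real" where
  "joint_density p n x \<alpha> \<beta> = (\<Prod>i=1..n. p \<alpha> \<beta> (x i))"

text \<open>Bayes' theorem.  The quotient is taken in \<open>[0, \<infinity>]\<close>, so it is \<open>0\<close> if the normalising
  integral is infinite.\<close>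

definition posterior_density ::
    "(real \<Rightarrow> real \<Rightarrow> real \<Rightarrow> real) \<Rightarrow> (real \<Rightarrow> real \<Rightarrow> real) \<Rightarrow> nat \<Rightarrow> (nat \<Rightarrow> real) \<Rightarrow>
      real \<Rightarrow> real \<Rightarrow> real" where
  "posterior_density p \<pi> n x \<alpha> \<beta> =
     enn2real (ennreal (joint_density p n x \<alpha> \<beta> * \<pi> \<alpha> \<beta>) /
               param_integral (\<lambda>a b. joint_density p n x a b * \<pi> a b))"

definition q1 :: "nat \<Rightarrow> (nat \<Rightarrow> real) \<Rightarrow> real" where
  "q1 n x = Min (x ` {1..n})"

definition q2 :: "nat \<Rightarrow> (nat \<Rightarrow> real) \<Rightarrow> real" where
  "q2 n x = (\<Sum>i=1..n. ln (x i))"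

lemma joint_density_pareto:
  assumes "n \<ge> 1" "\<alpha> > 0" "\<And>i. i \<in> {1..n} \<Longrightarrow> x i > 0"
  shows "joint_density pareto_density n x \<alpha> \<beta> =
    \<beta> ^ n * \<alpha> powr (real n * \<beta>) * (\<Prod>i=1..n. x i) powr (- \<beta> - 1) *
    indicator {\<alpha>..} (Min (x ` {1..n}))"
proof -
  have pd: "pareto_density \<alpha> \<beta> (x i) = \<beta> * \<alpha> powr \<beta> * x i powr (- \<beta> - 1) * indicator {\<alpha>..} (x i)"
    for i
  proof -
    have "- \<beta> - 1 = - (\<beta> + 1)" by simp
    then show ?thesis
      unfolding pareto_density_def by (simp only: powr_minus divide_inverse)
  qed
  have ind: "(\<Prod>i=1..n. indicator {\<alpha>..} (x i)) = (indicator {\<alpha>..} (Min (x ` {1..n})) :: real)"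
  proof (cases "\<forall>i\<in>{1..n}. \<alpha> \<le> x i")
    case True
    then show ?thesis using assms(1) by (auto simp: indicator_def)
  next
    case False
    then show ?thesis using assms(1) by (auto simp: indicator_def prod_zero_iff)
  qed
  have pw: "(\<Prod>i=1..n. x i powr (- \<beta> - 1)) = (\<Prod>i=1..n. x i) powr (- \<beta> - 1)"
    using assms(3) by (subst prod_powr_distrib) (auto intro: less_imp_le)
  have "(\<alpha> powr \<beta>) ^ n = \<alpha> powr (real n * \<beta>)"
    using assms(2) by (simp add: powr_power mult.commute)
  then show ?thesis
    unfolding joint_density_def pd
    by (simp only: prod.distrib ind pw) (simp add: power_mult_distrib)
qed

end

theory Submission
  imports Defs
begin

text \<open>
  With \<open>L = ln (X / \<alpha>)\<close>, the scores of the Pareto model are \<open>\<beta> / \<alpha>\<close> and \<open>1 / \<beta> - L\<close>.  Since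
  \<open>L\<close> is exponentially distributed with rate \<open>\<beta>\<close>, its moments make the Fisher metric diagonal with
  entries \<open>\<beta>\<^sup>2 / \<alpha>\<^sup>2\<close> and \<open>1 / \<beta>\<^sup>2\<close>, so the volume density is \<open>1 / \<alpha>\<close>.  Integrating likelihood
  times prior over \<open>0 < \<alpha> \<le> q\<^sub>1\<close> leaves a multiple of \<open>\<beta> ^ (n - 1) * exp (- s * \<beta>)\<close>, where
  \<open>s = q\<^sub>2 - n * ln q\<^sub>1\<close>, whose integral is \<open>\<Gamma>(n) / s ^ n\<close>.  If all observations coincide, then
  \<open>s = 0\<close>, the normalising integral is infinite, and both sides of the formula are \<open>0\<close>.
\<close>

section \<open>Gamma-type integrals over the half-line\<close>

text \<open>Recording only the derivative, the limit at infinity and the value at 0 makes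
  \<open>G\<close> usable twice: directly for integrals over \<beta>, and composed with
  \<open>ln (x / \<alpha>)\<close> for the moments of the Pareto law.\<close>

lemma power_exp_antiderivative:
  fixes s :: real
  assumes s: "s > 0"
  obtains G where "\<And>t. (G has_real_derivative t ^ k * exp (- s * t)) (at t)"
    and "(G \<longlongrightarrow> 0) at_top" and "G 0 = - fact k / s ^ Suc k"
proof -
  have lim: "((\<lambda>t. exp (- s * t) * t ^ k) \<longlongrightarrow> 0) at_top" for k
  proof -
    have st: "filterlim (\<lambda>t. s * t) at_top at_top"
      using s by (intro filterlim_tendsto_pos_mult_at_top[OF tendsto_const] filterlim_ident)
    have "((\<lambda>t. (s * t) ^ k / exp (s * t) * (1 / s ^ k)) \<longlongrightarrow> 0 * (1 / s ^ k)) at_top"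
      by (intro tendsto_intros filterlim_compose[OF tendsto_power_div_exp_0 st])
    then show ?thesis
      using s by (simp add: exp_minus field_simps power_mult_distrib)
  qed
  \<comment> \<open>\<open>F\<close> is the polynomial for which \<open>- exp (- s * t) * F t / s\<close> is the antiderivative.\<close>
  have "\<exists>F. (\<forall>t. (F has_real_derivative s * F t - s * t ^ k) (at t)) \<and>
          ((\<lambda>t. exp (- s * t) * F t) \<longlongrightarrow> 0) at_top \<and> F 0 = fact k / s ^ k"
  proof (induction k)
    case 0
    show ?case using lim[of 0] by (intro exI[of _ "\<lambda>_. 1"]) auto
  next
    case (Suc k)
    then obtain F where F: "\<And>t. (F has_real_derivative s * F t - s * t ^ k) (at t)"
      and F0: "((\<lambda>t. exp (- s * t) * F t) \<longlongrightarrow> 0) at_top" "F 0 = fact k / s ^ k" by blast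
    \<comment> \<open>Integration by parts gives the recursion: the terms
      \<open>Suc k * t ^ k\<close> cancel, and both sides of the differential equation for
      \<open>?F\<close> become \<open>Suc k * F t\<close>.\<close>
    let ?F = "\<lambda>t. t ^ Suc k + (real (Suc k) / s) * F t"
    have "(?F has_real_derivative s * ?F t - s * t ^ Suc k) (at t)" for t
      by (rule derivative_eq_intros F refl)+ (use s in \<open>simp add: field_simps\<close>)
    moreover have "((\<lambda>t. exp (- s * t) * t ^ Suc k + (real (Suc k) / s) * (exp (- s * t) * F t))
        \<longlongrightarrow> 0 + (real (Suc k) / s) * 0) at_top"
      by (intro tendsto_intros lim F0)
    then have "((\<lambda>t. exp (- s * t) * ?F t) \<longlongrightarrow> 0) at_top"
      by (simp add: algebra_simps)
    moreover have "?F 0 = fact (Suc k) / s ^ Suc k"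
      using F0(2) by simp
    ultimately show ?case by blast
  qed
  then obtain F where F: "\<And>t. (F has_real_derivative s * F t - s * t ^ k) (at t)"
    and F0: "((\<lambda>t. exp (- s * t) * F t) \<longlongrightarrow> 0) at_top" "F 0 = fact k / s ^ k" by blast
  let ?G = "\<lambda>t. (- 1 / s) * (exp (- s * t) * F t)"
  have "(?G has_real_derivative t ^ k * exp (- s * t)) (at t)" for t
    by (rule derivative_eq_intros F refl)+ (use s in \<open>simp add: field_simps\<close>)
  moreover have "(?G \<longlongrightarrow> (- 1 / s) * 0) at_top"
    by (intro tendsto_intros F0)
  moreover have "?G 0 = - fact k / s ^ Suc k"
    using F0(2) by simp
  ultimately show ?thesis
    using that[of ?G] by simp
qed

lemma nn_integral_power_exp_pos:
  fixes s :: real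
  assumes "s > 0"
  shows "(\<integral>\<^sup>+t\<in>{0<..}. ennreal (t ^ k * exp (- s * t)) \<partial>lborel) = ennreal (fact k / s ^ Suc k)"
proof -
  obtain G where G: "\<And>t. (G has_real_derivative t ^ k * exp (- s * t)) (at t)"
    "(G \<longlongrightarrow> 0) at_top" "G 0 = - fact k / s ^ Suc k"
    using power_exp_antiderivative[OF assms] by metis
  \<comment> \<open>The fundamental theorem is applied on the closed half-line. For
    \<open>k = 0\<close> the two integrands differ at 0, hence equality only almost
    everywhere.\<close>
  have "(\<integral>\<^sup>+t\<in>{0<..}. ennreal (t ^ k * exp (- s * t)) \<partial>lborel) =
      (\<integral>\<^sup>+t\<in>{0..}. ennreal (t ^ k * exp (- s * t)) \<partial>lborel)"
    by (intro nn_integral_cong_AE, use AE_lborel_singleton[of 0] in eventually_elim)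
      (auto simp: indicator_def)
  also have "\<dots> = ennreal (0 - G 0)"
    by (rule nn_integral_FTC_atLeast) (use G in auto)
  finally show ?thesis using G by simp
qed

text \<open>For \<open>t \<ge> 1\<close> the integrand is at least 1, so the integral dominates the
  length \<open>N\<close> of every interval \<open>{1..1 + N}\<close>.\<close>

lemma nn_integral_power_exp_nonneg:
  fixes s :: real
  assumes "s \<le> 0"
  shows "(\<integral>\<^sup>+t\<in>{0<..}. ennreal (t ^ k * exp (- s * t)) \<partial>lborel) = \<infinity>"
proof -
  have 1: "1 \<le> ennreal (t ^ k * exp (- s * t))" if "t \<ge> 1" for t
  proof -
    have "1 \<le> t ^ k * exp (- s * t)"
      using that assms mult_mono[of 1 "t ^ k" 1 "exp (- s * t)"]
      by (auto simp: mult_nonpos_nonneg one_le_power)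
    then show ?thesis
      using ennreal_leI ennreal_1 by metis
  qed
  have "of_nat N \<le> (\<integral>\<^sup>+t\<in>{0<..}. ennreal (t ^ k * exp (- s * t)) \<partial>lborel)" for N
  proof -
    have "of_nat N = (\<integral>\<^sup>+t. indicator {1..1 + real N} t \<partial>lborel)"
      by (simp add: ennreal_of_nat_eq_real_of_nat)
    also have "\<dots> \<le> (\<integral>\<^sup>+t\<in>{0<..}. ennreal (t ^ k * exp (- s * t)) \<partial>lborel)"
      using 1 by (intro nn_integral_mono) (simp add: indicator_def)
    finally show ?thesis .
  qed
  then show ?thesis
    by (metis ennreal_Ex_less_of_nat infinity_ennreal_def leD less_top)
qed

section \<open>The Fisher metric of the Pareto model\<close>

lemma pareto_density_measurable [measurable]: "pareto_density \<alpha> \<beta> \<in> borel_measurable borel"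
  unfolding pareto_density_def[abs_def] by measurable

lemma pareto_density_nonneg: "\<beta> \<ge> 0 \<Longrightarrow> pareto_density \<alpha> \<beta> x \<ge> 0"
  by (simp add: pareto_density_def)

text \<open>The substitution \<open>t = ln (x / \<alpha>)\<close> carries the Pareto law to the
  exponential law of rate \<beta>. It is performed on the antiderivative:
  \<open>\<beta> * G (ln (x / \<alpha>))\<close> differentiates to the integrand on the
  support.\<close>

lemma pareto_log_moment:
  assumes a: "\<alpha> > 0" and b: "\<beta> > 0"
  shows "has_bochner_integral lborel (\<lambda>x. pareto_density \<alpha> \<beta> x * ln (x / \<alpha>) ^ k)
    (fact k / \<beta> ^ k)"
proof -
  obtain G where G: "\<And>t. (G has_real_derivative t ^ k * exp (- \<beta> * t)) (at t)"
    "(G \<longlongrightarrow> 0) at_top" "G 0 = - fact k / \<beta> ^ Suc k"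
    using power_exp_antiderivative[OF b] by metis
  let ?g = "\<lambda>x. \<beta> * \<alpha> powr \<beta> / x powr (\<beta> + 1) * ln (x / \<alpha>) ^ k"
  have D: "((\<lambda>x. \<beta> * G (ln (x / \<alpha>))) has_real_derivative ?g x) (at x)" if "x \<ge> \<alpha>" for x
  proof -
    have x: "x > 0" using that a by simp
    have "((\<lambda>x. ln (x / \<alpha>)) has_real_derivative 1 / x) (at x)"
      using x a by (auto intro!: derivative_eq_intros)
    from DERIV_chain2[OF G(1) this]
    have "((\<lambda>x. \<beta> * G (ln (x / \<alpha>))) has_real_derivative
        \<beta> * (ln (x / \<alpha>) ^ k * exp (- \<beta> * ln (x / \<alpha>)) * (1 / x))) (at x)"
      by (rule DERIV_cmult)
    \<comment> \<open>The factor \<open>1 / x\<close> is the derivative of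
      \<open>ln (x / \<alpha>)\<close>; it raises the exponent of \<open>x\<close> from \<beta> to
      \<open>\<beta> + 1\<close>.\<close>
    moreover have eq: "exp (- \<beta> * ln (x / \<alpha>)) * (1 / x) = \<alpha> powr \<beta> / x powr (\<beta> + 1)"
      using x a by (simp add: powr_def ln_div algebra_simps exp_add exp_diff exp_minus field_simps)
    ultimately show ?thesis
      by (simp only: mult.assoc eq) (simp add: mult_ac)
  qed
  have "filterlim (\<lambda>x. 1 / \<alpha> * x) at_top at_top"
    using a by (intro filterlim_tendsto_pos_mult_at_top[OF tendsto_const] filterlim_ident) simp
  then have "filterlim (\<lambda>x. ln (x / \<alpha>)) at_top at_top"
    by (intro filterlim_compose[OF ln_at_top]) simp
  from filterlim_compose[OF G(2) this]
  have lim: "((\<lambda>x. \<beta> * G (ln (x / \<alpha>))) \<longlongrightarrow> \<beta> * 0) at_top"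
    by (intro tendsto_intros)
  have "(\<integral>\<^sup>+x\<in>{\<alpha>..}. ennreal (?g x) \<partial>lborel) = ennreal (\<beta> * 0 - \<beta> * G (ln (\<alpha> / \<alpha>)))"
    by (rule nn_integral_FTC_atLeast[OF _ D _ lim]) (use a b in auto)
  also have "\<beta> * 0 - \<beta> * G (ln (\<alpha> / \<alpha>)) = fact k / \<beta> ^ k"
    using a b G(3) by simp
  also have "(\<integral>\<^sup>+x\<in>{\<alpha>..}. ennreal (?g x) \<partial>lborel) =
      (\<integral>\<^sup>+x. ennreal (pareto_density \<alpha> \<beta> x * ln (x / \<alpha>) ^ k) \<partial>lborel)"
    by (intro nn_integral_cong) (auto simp: pareto_density_def indicator_def)
  \<comment> \<open>Where the density is nonzero, \<open>ln (x / \<alpha>) \<ge> 0\<close>; the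
    integrand is therefore nonnegative and the Bochner integral has the same value.\<close>
  finally show ?thesis
    using a b by (intro has_bochner_integral_nn_integral)
      (auto simp: pareto_density_def indicator_def)
qed

text \<open>Products of two scores are quadratic in \<open>ln (x / \<alpha>)\<close>, but only above
  \<alpha>. This suffices because the density vanishes below \<alpha> and the point \<alpha> is
  null. The factor 2 is \<open>fact 2\<close> from the second moment.\<close>

lemma pareto_expectation_quadratic:
  assumes a: "\<alpha> > 0" and b: "\<beta> > 0" and [measurable]: "f \<in> borel_measurable borel"
    and f: "\<And>x. x > \<alpha> \<Longrightarrow> f x = c0 + c1 * ln (x / \<alpha>) + c2 * ln (x / \<alpha>) ^ 2"
  shows "has_bochner_integral (model_law pareto_density \<alpha> \<beta>) f (c0 + c1 / \<beta> + 2 * c2 / \<beta>\<^sup>2)"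
proof -
  let ?h = "\<lambda>x k. pareto_density \<alpha> \<beta> x * ln (x / \<alpha>) ^ k"
  have "has_bochner_integral lborel (\<lambda>x. c0 * ?h x 0 + c1 * ?h x 1 + c2 * ?h x 2)
      (c0 * (fact 0 / \<beta> ^ 0) + c1 * (fact 1 / \<beta> ^ 1) + c2 * (fact 2 / \<beta> ^ 2))"
    by (intro has_bochner_integral_add has_bochner_integral_mult_right pareto_log_moment a b)
  then have "has_bochner_integral lborel (\<lambda>x. pareto_density \<alpha> \<beta> x *\<^sub>R f x)
      (c0 * (fact 0 / \<beta> ^ 0) + c1 * (fact 1 / \<beta> ^ 1) + c2 * (fact 2 / \<beta> ^ 2))"
  proof (rule has_bochner_integralI_AE)
    show "(\<lambda>x. pareto_density \<alpha> \<beta> x *\<^sub>R f x) \<in> borel_measurable lborel" by measurable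
    show "AE x in lborel. c0 * ?h x 0 + c1 * ?h x 1 + c2 * ?h x 2 = pareto_density \<alpha> \<beta> x *\<^sub>R f x"
      using AE_lborel_singleton[of \<alpha>]
    proof eventually_elim
      case (elim x)
      then show ?case
        by (cases "x > \<alpha>") (auto simp: f pareto_density_def algebra_simps)
    qed
  qed
  then have "has_bochner_integral (model_law pareto_density \<alpha> \<beta>) f
      (c0 * (fact 0 / \<beta> ^ 0) + c1 * (fact 1 / \<beta> ^ 1) + c2 * (fact 2 / \<beta> ^ 2))"
    unfolding model_law_def using b
    by (intro has_bochner_integral_density) (auto simp: pareto_density_nonneg)
  then show ?thesis by (simp add: fact_2 mult.commute)
qed

lemma pareto_loglik:
  assumes "\<alpha> > 0" "\<beta> > 0" "x \<ge> \<alpha>"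
  shows "ln (pareto_density \<alpha> \<beta> x) = ln \<beta> + \<beta> * ln \<alpha> - (\<beta> + 1) * ln x"
  using assms by (simp add: pareto_density_def ln_mult ln_div ln_powr)

text \<open>The support moves with \<open>a\<close>, so the closed form of the log-likelihood holds
  only for \<open>0 < a < x\<close>; this is a neighbourhood of \<alpha> when
  \<open>x > \<alpha>\<close>. Varying \<beta> leaves the support fixed, so
  \<open>pareto_loglik_DERIV_shape\<close> admits \<open>x = \<alpha>\<close>.\<close>

lemma pareto_loglik_DERIV_scale:
  assumes "\<alpha> > 0" "\<beta> > 0" "x > \<alpha>"
  shows "((\<lambda>a. ln (pareto_density a \<beta> x)) has_real_derivative \<beta> / \<alpha>) (at \<alpha>)"
proof (rule has_field_derivative_transform_within_open)
  show "((\<lambda>a. ln \<beta> + \<beta> * ln a - (\<beta> + 1) * ln x) has_real_derivative \<beta> / \<alpha>) (at \<alpha>)"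
    using assms by (auto intro!: derivative_eq_intros)
  show "ln \<beta> + \<beta> * ln a - (\<beta> + 1) * ln x = ln (pareto_density a \<beta> x)" if "a \<in> {0<..<x}" for a
    using that assms by (intro pareto_loglik[symmetric]) auto
qed (use assms in auto)

lemma pareto_loglik_DERIV_shape:
  assumes "\<alpha> > 0" "\<beta> > 0" "x \<ge> \<alpha>"
  shows "((\<lambda>b. ln (pareto_density \<alpha> b x)) has_real_derivative 1 / \<beta> - ln (x / \<alpha>)) (at \<beta>)"
proof (rule has_field_derivative_transform_within_open)
  show "((\<lambda>b. ln b + b * ln \<alpha> - (b + 1) * ln x) has_real_derivative 1 / \<beta> - ln (x / \<alpha>)) (at \<beta>)"
    using assms by (auto intro!: derivative_eq_intros simp: ln_div)
  show "ln b + b * ln \<alpha> - (b + 1) * ln x = ln (pareto_density \<alpha> b x)" if "b \<in> {0<..}" for b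
    using that assms by (intro pareto_loglik[symmetric]) auto
qed (use assms in auto)

text \<open>At \<open>x = \<alpha>\<close> the log-likelihood is not differentiable in \<open>\<alpha>\<close>, so the score has an unspecified
  value there; below \<open>\<alpha>\<close> it vanishes because \<open>ln 0 = 0\<close>.\<close>

lemma pareto_score_1:
  assumes "\<alpha> > 0" "\<beta> > 0"
  shows "score pareto_density 1 \<alpha> \<beta> x =
    (if x < \<alpha> then 0 else if x = \<alpha> then score pareto_density 1 \<alpha> \<beta> \<alpha> else \<beta> / \<alpha>)"
proof -
  have "deriv (\<lambda>a. ln (pareto_density a \<beta> x)) \<alpha> = 0" if "x < \<alpha>"
  proof (rule DERIV_imp_deriv, rule has_field_derivative_transform_within_open)
    show "((\<lambda>_. 0) has_real_derivative 0) (at \<alpha>)" by simp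
    show "0 = ln (pareto_density a \<beta> x)" if "a \<in> {x<..}" for a
      using that by (simp add: pareto_density_def)
  qed (use that in auto)
  moreover have "deriv (\<lambda>a. ln (pareto_density a \<beta> x)) \<alpha> = \<beta> / \<alpha>" if "x > \<alpha>"
    by (rule DERIV_imp_deriv[OF pareto_loglik_DERIV_scale[OF assms that]])
  ultimately show ?thesis by (auto simp: score_def)
qed

lemma pareto_score_2:
  assumes "\<alpha> > 0" "\<beta> > 0"
  shows "score pareto_density 2 \<alpha> \<beta> x = (if x < \<alpha> then 0 else 1 / \<beta> - ln (x / \<alpha>))"
proof -
  have "deriv (\<lambda>b. ln (pareto_density \<alpha> b x)) \<beta> = 0" if "x < \<alpha>"
    using that by (simp add: pareto_density_def)
  moreover have "deriv (\<lambda>b. ln (pareto_density \<alpha> b x)) \<beta> = 1 / \<beta> - ln (x / \<alpha>)" if "x \<ge> \<alpha>"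
    by (rule DERIV_imp_deriv[OF pareto_loglik_DERIV_shape[OF assms that]])
  ultimately show ?thesis by (auto simp: score_def)
qed

text \<open>Measurability in \<open>x\<close> is read off the piecewise formulas, in which the
  unspecified value at \<alpha> is just a constant on a single point.\<close>

lemma pareto_score_measurable [measurable]:
  assumes "\<alpha> > 0" "\<beta> > 0"
  shows "score pareto_density i \<alpha> \<beta> \<in> borel_measurable borel"
proof -
  have "score pareto_density 1 \<alpha> \<beta> \<in> borel_measurable borel"
    by (subst pareto_score_1[OF assms, abs_def]) measurable
  moreover have "score pareto_density 2 \<alpha> \<beta> \<in> borel_measurable borel"
    by (subst pareto_score_2[OF assms, abs_def]) measurable
  ultimately show ?thesis
    using exhaust_2[of i] by auto
qed

lemma pareto_fisher_integrals:
  assumes a: "\<alpha> > 0" and b: "\<beta> > 0"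
  shows "has_bochner_integral (model_law pareto_density \<alpha> \<beta>)
    (\<lambda>x. score pareto_density i \<alpha> \<beta> x * score pareto_density j \<alpha> \<beta> x)
    (if i \<noteq> j then 0 else if i = 1 then (\<beta> / \<alpha>)\<^sup>2 else 1 / \<beta>\<^sup>2)"
proof -
  let ?s = "\<lambda>i x. score pareto_density i \<alpha> \<beta> x"
  have [measurable]: "?s i \<in> borel_measurable borel" for i
    by (rule pareto_score_measurable[OF a b])
  note quad = pareto_expectation_quadratic[OF a b]
  have s: "?s 1 x = \<beta> / \<alpha>" "?s 2 x = 1 / \<beta> - ln (x / \<alpha>)" if "x > \<alpha>" for x
    using that pareto_score_1[OF a b, of x] pareto_score_2[OF a b, of x] by auto
  have 11: "has_bochner_integral (model_law pareto_density \<alpha> \<beta>) (\<lambda>x. ?s 1 x * ?s 1 x) ((\<beta> / \<alpha>)\<^sup>2)"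
    using quad[of "\<lambda>x. ?s 1 x * ?s 1 x" "(\<beta> / \<alpha>)\<^sup>2" 0 0] by (simp add: s power2_eq_square)
  have 12: "has_bochner_integral (model_law pareto_density \<alpha> \<beta>) (\<lambda>x. ?s 1 x * ?s 2 x) 0"
  proof -
    \<comment> \<open>The first score is constant above \<alpha> and the second has mean zero:
      \<open>1 / \<alpha> - (\<beta> / \<alpha>) / \<beta> = 0\<close>.\<close>
    have "?s 1 x * ?s 2 x = 1 / \<alpha> + (- \<beta> / \<alpha>) * ln (x / \<alpha>) + 0 * ln (x / \<alpha>) ^ 2" if "x > \<alpha>" for x
      using a b by (simp add: s that field_simps)
    from quad[OF _ this] show ?thesis using a b by simp
  qed
  have 22: "has_bochner_integral (model_law pareto_density \<alpha> \<beta>) (\<lambda>x. ?s 2 x * ?s 2 x) (1 / \<beta>\<^sup>2)"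
  proof -
    \<comment> \<open>The three contributions are \<open>1 / \<beta>\<^sup>2\<close>,
      \<open>- 2 / \<beta>\<^sup>2\<close> and \<open>2 / \<beta>\<^sup>2\<close>; their sum is the
      variance of the exponential variable.\<close>
    have "?s 2 x * ?s 2 x = 1 / \<beta>\<^sup>2 + (- 2 / \<beta>) * ln (x / \<alpha>) + 1 * ln (x / \<alpha>) ^ 2" if "x > \<alpha>" for x
      using b by (simp add: s that field_simps power2_eq_square)
    from quad[OF _ this] show ?thesis using b by (simp add: field_simps power2_eq_square)
  qed
  show ?thesis
    using exhaust_2[of i] exhaust_2[of j] 11 12 12[unfolded mult.commute[of "?s 1 _"]] 22
    by (elim disjE) simp_all
qed

text \<open>Under the model law only points of positive density matter, that is
  \<open>x \<ge> \<alpha>\<close>. Differentiability in the scale can fail there only at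
  \<open>x = \<alpha>\<close>, a null set.\<close>

lemma pareto_fisher_metric_exists:
  assumes a: "\<alpha> > 0" and b: "\<beta> > 0"
  shows "fisher_metric_exists pareto_density \<alpha> \<beta>"
proof -
  have "AE x in lborel. 0 < ennreal (pareto_density \<alpha> \<beta> x) \<longrightarrow>
      (\<lambda>a. ln (pareto_density a \<beta> x)) field_differentiable at \<alpha> \<and>
      (\<lambda>b. ln (pareto_density \<alpha> b x)) field_differentiable at \<beta>"
    using AE_lborel_singleton[of \<alpha>]
  proof eventually_elim
    case (elim x)
    then show ?case
      using pareto_loglik_DERIV_scale[OF a b, of x] pareto_loglik_DERIV_shape[OF a b, of x]
      by (cases "x > \<alpha>") (auto simp: field_differentiable_def pareto_density_def)
  qed
  then show ?thesis
    unfolding fisher_metric_exists_def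
    by (intro conjI allI integrable.intros[OF pareto_fisher_integrals[OF a b]])
      (simp only: model_law_def, subst AE_density, measurable)
qed

lemma pareto_sqrt_det_fisher_metric:
  assumes a: "\<alpha> > 0" and b: "\<beta> > 0"
  shows "sqrt (det (fisher_metric pareto_density \<alpha> \<beta>)) = 1 / \<alpha>"
proof -
  have "fisher_metric pareto_density \<alpha> \<beta> $ i $ j =
      (if i \<noteq> j then 0 else if i = 1 then (\<beta> / \<alpha>)\<^sup>2 else 1 / \<beta>\<^sup>2)" for i j
    using pareto_fisher_integrals[OF a b, of i j]
    by (simp add: fisher_metric_def has_bochner_integral_iff)
  then have "det (fisher_metric pareto_density \<alpha> \<beta>) = (1 / \<alpha>)\<^sup>2"
    using a b by (simp add: det_2 field_simps)
  then show ?thesis using a by simp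
qed

lemma jeffreys_prior_pareto:
  "jeffreys_prior pareto_density \<pi> \<longleftrightarrow> (\<exists>c>0. \<forall>\<alpha>>0. \<forall>\<beta>>0. \<pi> \<alpha> \<beta> = c * (1 / \<alpha>))"
  by (auto simp: jeffreys_prior_def pareto_fisher_metric_exists pareto_sqrt_det_fisher_metric)

section \<open>Integrals over the parameter space\<close>

text \<open>\<open>jeffreys_prior\<close> determines \<pi> only at positive parameters, so
  integrands may be compared only there.\<close>

lemma param_integral_cong:
  assumes "\<And>\<alpha> \<beta>. \<alpha> > 0 \<Longrightarrow> \<beta> > 0 \<Longrightarrow> f \<alpha> \<beta> = g \<alpha> \<beta>"
  shows "param_integral f = param_integral g"
  unfolding param_integral_def
  by (intro nn_integral_cong) (auto simp: indicator_def assms intro!: nn_integral_cong)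

lemma nn_integral_inverse_pos:
  assumes c: "c > 0"
  shows "(\<integral>\<^sup>+\<alpha>\<in>{0<..}. ennreal (c * (1 / \<alpha>)) \<partial>lborel) = \<infinity>"
proof -
  have "of_nat N \<le> (\<integral>\<^sup>+\<alpha>\<in>{0<..}. ennreal (c * (1 / \<alpha>)) \<partial>lborel)" for N
  proof -
    \<comment> \<open>The endpoint is chosen so that \<open>c * ln ?e = N\<close>; the divergence at
      infinity alone suffices.\<close>
    let ?e = "exp (real N / c)"
    have "(\<integral>\<^sup>+\<alpha>\<in>{1..?e}. ennreal (c * (1 / \<alpha>)) \<partial>lborel) = ennreal (c * ln ?e - c * ln 1)"
    proof (rule nn_integral_FTC_Icc)
      show "((\<lambda>x. c * ln x) has_real_derivative c * (1 / x)) (at x)"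
        if "x \<in> {1..?e}" for x
        using that by (auto intro!: derivative_eq_intros)
    qed (use c in auto)
    then have "of_nat N = (\<integral>\<^sup>+\<alpha>\<in>{1..?e}. ennreal (c * (1 / \<alpha>)) \<partial>lborel)"
      using c by (simp add: ennreal_of_nat_eq_real_of_nat)
    also have "\<dots> \<le> (\<integral>\<^sup>+\<alpha>\<in>{0<..}. ennreal (c * (1 / \<alpha>)) \<partial>lborel)"
      by (intro nn_integral_mono) (auto simp: indicator_def)
    finally show ?thesis .
  qed
  then show ?thesis
    by (metis ennreal_Ex_less_of_nat infinity_ennreal_def leD less_top)
qed

lemma improper_prior_inverse:
  assumes "c > 0" "\<forall>\<alpha>>0. \<forall>\<beta>>0. \<pi> \<alpha> \<beta> = c * (1 / \<alpha>)"
  shows "improper_prior \<pi>"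
proof -
  have "param_integral \<pi> = param_integral (\<lambda>\<alpha> \<beta>. c * (1 / \<alpha>))"
    by (rule param_integral_cong) (use assms(2) in blast)
  also have "\<dots> = \<infinity> * emeasure lborel {0::real<..}"
    unfolding param_integral_def nn_integral_inverse_pos[OF assms(1)]
    by (rule nn_integral_cmult_indicator) simp
  also have "\<dots> = \<infinity>"
    \<comment> \<open>With both arguments 0 the integrand is 1, so this instance is the infinite
      Lebesgue measure of the half-line.\<close>
    using nn_integral_power_exp_nonneg[of 0 0] by (simp add: ennreal_top_mult)
  finally show ?thesis by (simp add: improper_prior_def)
qed

text \<open>For \<open>r < 1\<close> the integrand is unbounded near 0, so the value comes from the
  improper power integral.\<close>

lemma nn_integral_powr_Ioc:
  assumes "r > (0::real)" "q \<ge> 0"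
  shows "(\<integral>\<^sup>+x\<in>{0<..}. ennreal (x powr (r - 1) * indicator {0<..q} x) \<partial>lborel) =
    ennreal (q powr r / r)"
proof -
  have "((\<lambda>x. x powr (r - 1)) has_integral q powr r / r) {0..q}"
    using has_integral_powr_from_0[of "r - 1" q] assms by simp
  then have "(\<integral>\<^sup>+x. indicator {0..q} x * x powr (r - 1) \<partial>lborel) = ennreal (q powr r / r)"
    by (intro nn_integral_has_integral_lebesgue) auto
  \<comment> \<open>At \<open>x = 0\<close> both integrands vanish, since
    \<open>0 powr y = 0\<close>.\<close>
  moreover have "(\<integral>\<^sup>+x\<in>{0<..}. ennreal (x powr (r - 1) * indicator {0<..q} x) \<partial>lborel) =
      (\<integral>\<^sup>+x. indicator {0..q} x * x powr (r - 1) \<partial>lborel)"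
    by (intro nn_integral_cong) (auto simp: indicator_def)
  ultimately show ?thesis by simp
qed

text \<open>Integrating over \<alpha> gives \<open>q powr (n * \<beta>) / (n * \<beta>)\<close>. The
  numerator turns \<open>exp (- Q * \<beta>)\<close> into \<open>exp (- s * \<beta>)\<close>, and
  the denominator lowers the power of \<beta> to \<open>m = n - 1\<close>. The constant
  \<open>K\<close> is kept general to cover both the Bayes denominator and the total mass of the
  posterior.\<close>

lemma param_integral_posterior_kernel:
  fixes n :: nat and K Q q :: real
  assumes K: "K > 0" and n: "n \<ge> 1" and q: "q > 0"
  defines "s \<equiv> Q - real n * ln q"
  shows "param_integral (\<lambda>\<alpha> \<beta>. K * (\<beta> ^ n * \<alpha> powr (real n * \<beta> - 1) * exp (- Q * \<beta>) *
      indicator {0<..q} \<alpha>)) = (if s > 0 then ennreal (K * Gamma (real n) / (real n * s ^ n)) else \<infinity>)"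
proof -
  obtain m where m: "n = Suc m" using n by (cases n) auto
  have inner: "(\<integral>\<^sup>+\<alpha>\<in>{0<..}. ennreal (K * (\<beta> ^ n * \<alpha> powr (real n * \<beta> - 1) * exp (- Q * \<beta>) *
      indicator {0<..q} \<alpha>)) \<partial>lborel) = ennreal (K / n) * ennreal (\<beta> ^ m * exp (- s * \<beta>))"
    if b: "\<beta> > 0" for \<beta>
  proof -
    have "(\<integral>\<^sup>+\<alpha>\<in>{0<..}. ennreal (K * (\<beta> ^ n * \<alpha> powr (real n * \<beta> - 1) * exp (- Q * \<beta>) *
        indicator {0<..q} \<alpha>)) \<partial>lborel) =
      (\<integral>\<^sup>+\<alpha>. ennreal (K * \<beta> ^ n * exp (- Q * \<beta>)) *
        (ennreal (\<alpha> powr (real n * \<beta> - 1) * indicator {0<..q} \<alpha>) * indicator {0<..} \<alpha>) \<partial>lborel)"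
      using K b by (intro nn_integral_cong) (auto simp: indicator_def mult_ac simp flip: ennreal_mult)
    also have "\<dots> = ennreal (K * \<beta> ^ n * exp (- Q * \<beta>)) * ennreal (q powr (real n * \<beta>) / (real n * \<beta>))"
      using nn_integral_powr_Ioc[of "real n * \<beta>" q] n b q by (subst nn_integral_cmult) auto
    also have "\<dots> = ennreal (K / n) * ennreal (\<beta> ^ m * exp (- s * \<beta>))"
    proof -
      have "exp (- Q * \<beta>) * q powr (real n * \<beta>) = exp (- s * \<beta>)"
        using q by (simp add: powr_def s_def algebra_simps flip: exp_add)
      moreover have "K * \<beta> ^ n * exp (- Q * \<beta>) * (q powr (real n * \<beta>) / (real n * \<beta>)) =
          K / n * (\<beta> ^ m * (exp (- Q * \<beta>) * q powr (real n * \<beta>)))"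
        using b n by (simp add: m field_simps del: of_nat_Suc)
      ultimately show ?thesis
        using K b by (simp flip: ennreal_mult)
    qed
    finally show ?thesis .
  qed
  have "param_integral (\<lambda>\<alpha> \<beta>. K * (\<beta> ^ n * \<alpha> powr (real n * \<beta> - 1) * exp (- Q * \<beta>) *
      indicator {0<..q} \<alpha>)) =
    (\<integral>\<^sup>+\<beta>. ennreal (K / n) * (ennreal (\<beta> ^ m * exp (- s * \<beta>)) * indicator {0<..} \<beta>) \<partial>lborel)"
    unfolding param_integral_def
  proof (intro nn_integral_cong)
    show "(\<integral>\<^sup>+\<alpha>\<in>{0<..}. ennreal (K * (\<beta> ^ n * \<alpha> powr (real n * \<beta> - 1) * exp (- Q * \<beta>) *
        indicator {0<..q} \<alpha>)) \<partial>lborel) * indicator {0<..} \<beta> =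
      ennreal (K / n) * (ennreal (\<beta> ^ m * exp (- s * \<beta>)) * indicator {0<..} \<beta>)" for \<beta>
      using inner[of \<beta>] by (cases "\<beta> > 0") simp_all
  qed
  also have "\<dots> = ennreal (K / n) * (\<integral>\<^sup>+\<beta>\<in>{0<..}. ennreal (\<beta> ^ m * exp (- s * \<beta>)) \<partial>lborel)"
    by (rule nn_integral_cmult) measurable
  also have "\<dots> = (if s > 0 then ennreal (K * Gamma (real n) / (real n * s ^ n)) else \<infinity>)"
  proof (cases "s > 0")
    case True
    have "Gamma (real n) = fact m"
      using Gamma_fact[of m, where 'a = real] by (simp add: m)
    with True K show ?thesis
      by (simp only: nn_integral_power_exp_pos) (simp add: m flip: ennreal_mult)
  next
    case False
    then have "(\<integral>\<^sup>+\<beta>\<in>{0<..}. ennreal (\<beta> ^ m * exp (- s * \<beta>)) \<partial>lborel) = \<infinity>"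
      by (intro nn_integral_power_exp_nonneg) simp
    with False K n show ?thesis
      by (simp only:) (simp add: ennreal_mult_top)
  qed
  finally show ?thesis .
qed

section \<open>The posterior\<close>

lemma q1_pos:
  assumes "n \<ge> 1" "\<forall>i\<in>{1..n}. x i > 0"
  shows "q1 n x > 0"
  using assms by (auto simp: q1_def)

lemma q1_le: "i \<in> {1..n} \<Longrightarrow> q1 n x \<le> x i"
  by (simp add: q1_def)

text \<open>This form shows the sign: for positive data each summand is nonnegative, because
  \<open>q1\<close> is the minimum.\<close>

lemma q2_minus_ln_q1:
  "q2 n x - real n * ln (q1 n x) = (\<Sum>i=1..n. ln (x i) - ln (q1 n x))"
  by (simp add: q2_def sum_subtractf)

lemma ln_q1_le:
  assumes "n \<ge> 1" "\<forall>i\<in>{1..n}. x i > 0" "i \<in> {1..n}"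
  shows "ln (q1 n x) \<le> ln (x i)"
  using q1_pos[OF assms(1,2)] q1_le[OF assms(3)] assms by simp

lemma q2_minus_ln_q1_nonneg:
  assumes "n \<ge> 1" "\<forall>i\<in>{1..n}. x i > 0"
  shows "q2 n x - real n * ln (q1 n x) \<ge> 0"
  unfolding q2_minus_ln_q1 using ln_q1_le[OF assms] by (intro sum_nonneg) simp

lemma q2_minus_ln_q1_pos:
  assumes "n \<ge> 1" "\<forall>i\<in>{1..n}. x i > 0" "\<exists>i\<in>{1..n}. \<exists>j\<in>{1..n}. x i \<noteq> x j"
  shows "q2 n x - real n * ln (q1 n x) > 0"
proof -
  \<comment> \<open>Two distinct observations cannot both equal the minimum; the one that differs
    contributes a strictly positive summand.\<close>
  obtain i where i: "i \<in> {1..n}" "x i \<noteq> q1 n x" using assms(3) by metis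
  with q1_le[of i n x] q1_pos[OF assms(1,2)] have "ln (q1 n x) < ln (x i)" by simp
  then show ?thesis
    unfolding q2_minus_ln_q1 using ln_q1_le[OF assms(1,2)] i
    by (intro sum_pos2[of _ i]) auto
qed

text \<open>The power of the product of the data splits into \<open>exp (- q2 n x * \<beta>)\<close>
  and the parameter-free \<open>exp (- q2 n x)\<close>, which will cancel in the posterior. The
  indicator is reread as a condition on \<alpha>.\<close>

lemma pareto_joint_times_inverse:
  assumes n: "n \<ge> 1" and x: "\<forall>i\<in>{1..n}. x i > 0" and a: "\<alpha> > 0"
  shows "joint_density pareto_density n x \<alpha> \<beta> * (c * (1 / \<alpha>)) =
    c * exp (- q2 n x) * (\<beta> ^ n * \<alpha> powr (real n * \<beta> - 1) * exp (- q2 n x * \<beta>) *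
      indicator {0<..q1 n x} \<alpha>)"
proof -
  have "(\<Prod>i=1..n. x i) > 0" using x by (intro prod_pos) auto
  moreover have "ln (\<Prod>i=1..n. x i) = q2 n x"
    unfolding q2_def by (intro ln_prod) (simp, use x in force)
  ultimately have "(\<Prod>i=1..n. x i) powr (- \<beta> - 1) = exp (- q2 n x) * exp (- q2 n x * \<beta>)"
    by (simp add: powr_def algebra_simps del: prod_zero_iff flip: exp_add)
  moreover have "\<alpha> powr (real n * \<beta> - 1) = \<alpha> powr (real n * \<beta>) * (1 / \<alpha>)"
    using a by (simp add: powr_diff)
  moreover have "indicator {\<alpha>..} (Min (x ` {1..n})) = (indicator {0<..q1 n x} \<alpha> :: real)"
    using a by (simp add: indicator_def q1_def)
  moreover have "joint_density pareto_density n x \<alpha> \<beta> =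
    \<beta> ^ n * \<alpha> powr (real n * \<beta>) * (\<Prod>i=1..n. x i) powr (- \<beta> - 1) *
    indicator {\<alpha>..} (Min (x ` {1..n}))"
    using joint_density_pareto n a x by blast
  ultimately show ?thesis by (simp only:) (simp add: mult_ac)
qed

lemma posterior_density_pareto:
  fixes n :: nat and x :: "nat \<Rightarrow> real"
  assumes c: "c > 0" and \<pi>: "\<forall>\<alpha>>0. \<forall>\<beta>>0. \<pi> \<alpha> \<beta> = c * (1 / \<alpha>)"
    and n: "n \<ge> 1" and x: "\<forall>i\<in>{1..n}. x i > 0" and a: "\<alpha> > 0" and b: "\<beta> > 0"
  shows "posterior_density pareto_density \<pi> n x \<alpha> \<beta> =
    real n * (q2 n x - real n * ln (q1 n x)) ^ n / Gamma (real n) *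
    (\<beta> ^ n * \<alpha> powr (real n * \<beta> - 1) * exp (- q2 n x * \<beta>) * indicator {0<..q1 n x} \<alpha>)"
proof -
  define s where "s = q2 n x - real n * ln (q1 n x)"
  define K where "K = c * exp (- q2 n x)"
  define k :: "real \<Rightarrow> real \<Rightarrow> real" where "k = (\<lambda>\<alpha> \<beta>. \<beta> ^ n * \<alpha> powr (real n * \<beta> - 1) * exp (- q2 n x * \<beta>) *
      indicator {0<..q1 n x} \<alpha>)"
  have K: "K > 0" using c by (simp add: K_def)
  have k: "k \<alpha> \<beta> \<ge> 0" using b by (simp add: k_def)
  have Gamma: "Gamma (real n) > 0" using n by (intro Gamma_real_pos) simp
  have s: "s \<ge> 0" unfolding s_def by (rule q2_minus_ln_q1_nonneg[OF n x])
  have eq: "joint_density pareto_density n x \<alpha> \<beta> * \<pi> \<alpha> \<beta> = K * k \<alpha> \<beta>"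
    if "\<alpha> > 0" "\<beta> > 0" for \<alpha> \<beta>
    using pareto_joint_times_inverse[OF n x that(1)] \<pi> that by (simp add: K_def k_def)
  have "param_integral (\<lambda>\<alpha> \<beta>. joint_density pareto_density n x \<alpha> \<beta> * \<pi> \<alpha> \<beta>) =
      param_integral (\<lambda>\<alpha> \<beta>. K * k \<alpha> \<beta>)"
    by (rule param_integral_cong) (rule eq)
  also have "\<dots> = (if s > 0 then ennreal (K * Gamma (real n) / (real n * s ^ n)) else \<infinity>)"
    unfolding k_def s_def by (rule param_integral_posterior_kernel[OF K n q1_pos[OF n x]])
  finally have post: "posterior_density pareto_density \<pi> n x \<alpha> \<beta> = enn2real (ennreal (K * k \<alpha> \<beta>) /
      (if s > 0 then ennreal (K * Gamma (real n) / (real n * s ^ n)) else \<infinity>))"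
    by (simp add: posterior_density_def eq[OF a b])
  show ?thesis
  proof (cases "s > 0")
    case True
    then have D: "K * Gamma (real n) / (real n * s ^ n) > 0"
      using K n Gamma by simp
    have N: "K * k \<alpha> \<beta> \<ge> 0"
      using K k by simp
    have "posterior_density pareto_density \<pi> n x \<alpha> \<beta> =
        (K * k \<alpha> \<beta>) / (K * Gamma (real n) / (real n * s ^ n))"
      by (simp only: post True if_True divide_ennreal[OF N D] enn2real_ennreal[OF divide_nonneg_pos[OF N D]])
    then show ?thesis
      using K by (simp add: s_def k_def)
  next
    \<comment> \<open>Division by infinity gives 0 on the left; on the right the factor
      \<open>0 ^ n\<close> vanishes because \<open>n \<ge> 1\<close>. A single observation always
      falls under this case.\<close>
    case False
    with s have "s = 0" by simp
    with post n show ?thesis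
      by (simp add: s_def ennreal_divide_top)
  qed
qed

theorem mainTheorem6:
  shows "(\<forall>\<pi>. jeffreys_prior pareto_density \<pi> \<longleftrightarrow>
            (\<exists>c>0. \<forall>\<alpha>>0. \<forall>\<beta>>0. \<pi> \<alpha> \<beta> = c * (1 / \<alpha>))) \<and>
         (\<forall>\<pi>. jeffreys_prior pareto_density \<pi> \<longrightarrow> improper_prior \<pi>) \<and>
         (\<forall>\<pi> (n::nat) (x::nat \<Rightarrow> real).
            jeffreys_prior pareto_density \<pi> \<longrightarrow> n \<ge> 1 \<longrightarrow> (\<forall>i\<in>{1..n}. x i > 0) \<longrightarrow>
            (\<forall>\<alpha>>0. \<forall>\<beta>>0.
               posterior_density pareto_density \<pi> n x \<alpha> \<beta> =
                 real n * (q2 n x - real n * ln (q1 n x)) ^ n / Gamma (real n) *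
                 \<beta> ^ n * \<alpha> powr (real n * \<beta> - 1) * exp (- q2 n x * \<beta>) *
                 indicator {0<..q1 n x} \<alpha>) \<and>
            ((\<exists>i\<in>{1..n}. \<exists>j\<in>{1..n}. x i \<noteq> x j) \<longrightarrow>
               param_integral (posterior_density pareto_density \<pi> n x) = 1))"
proof (intro conjI allI impI)
  fix \<pi>
  show "jeffreys_prior pareto_density \<pi> \<longleftrightarrow> (\<exists>c>0. \<forall>\<alpha>>0. \<forall>\<beta>>0. \<pi> \<alpha> \<beta> = c * (1 / \<alpha>))"
    by (rule jeffreys_prior_pareto)
  assume "jeffreys_prior pareto_density \<pi>"
  then obtain c where c: "c > 0" "\<forall>\<alpha>>0. \<forall>\<beta>>0. \<pi> \<alpha> \<beta> = c * (1 / \<alpha>)"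
    unfolding jeffreys_prior_pareto by blast
  show "improper_prior \<pi>"
    by (rule improper_prior_inverse[OF c])
  fix n :: nat and x :: "nat \<Rightarrow> real"
  assume n: "n \<ge> 1" and x: "\<forall>i\<in>{1..n}. x i > 0"
  note post = posterior_density_pareto[OF c n x]
  show "posterior_density pareto_density \<pi> n x \<alpha> \<beta> =
      real n * (q2 n x - real n * ln (q1 n x)) ^ n / Gamma (real n) *
      \<beta> ^ n * \<alpha> powr (real n * \<beta> - 1) * exp (- q2 n x * \<beta>) * indicator {0<..q1 n x} \<alpha>"
    if "\<alpha> > 0" "\<beta> > 0" for \<alpha> \<beta>
    using post[OF that] by (simp only: mult.assoc)
  assume "\<exists>i\<in>{1..n}. \<exists>j\<in>{1..n}. x i \<noteq> x j"
  then have s: "q2 n x - real n * ln (q1 n x) > 0"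
    by (rule q2_minus_ln_q1_pos[OF n x])
  have Gamma: "Gamma (real n) > 0" using n by (intro Gamma_real_pos) simp
  have K: "real n * (q2 n x - real n * ln (q1 n x)) ^ n / Gamma (real n) > 0"
    using s n Gamma by simp
  \<comment> \<open>The kernel integral is reused with the normalising factor itself as
    \<open>K\<close>, and everything cancels to 1.\<close>
  have "param_integral (posterior_density pareto_density \<pi> n x) =
      param_integral (\<lambda>\<alpha> \<beta>. real n * (q2 n x - real n * ln (q1 n x)) ^ n / Gamma (real n) *
        (\<beta> ^ n * \<alpha> powr (real n * \<beta> - 1) * exp (- q2 n x * \<beta>) * indicator {0<..q1 n x} \<alpha>))"
    by (rule param_integral_cong) (rule post)
  also have "\<dots> = ennreal (real n * (q2 n x - real n * ln (q1 n x)) ^ n / Gamma (real n) *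
      Gamma (real n) / (real n * (q2 n x - real n * ln (q1 n x)) ^ n))"
    by (simp only: param_integral_posterior_kernel[OF K n q1_pos[OF n x]] s if_True)
  also have "\<dots> = 1"
    using s n Gamma[THEN less_imp_neq] by simp
  finally show "param_integral (posterior_density pareto_density \<pi> n x) = 1" .
qed

end
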